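(* Let $0<\alpha\le \pi/2$, let $\Delta=\Delta(\alpha)=\{re^{i\theta} : r\ge 0,\ |\theta|\le\alpha\}$, and let $\{T_t\}_{t\in\Delta}$ be a $C_0$-semigroup on a separable Banach space $X$. If $\{T_t\}_{t\in\Delta}$ is frequently hypercyclic, then it is $\mathcal{F}_{pld}$-transitive, i.e. for any non-empty open sets $U,V\subset X$ the set $N(U,V):=\{t\in\Delta : T_tU\cap V\ne\emptyset\}$ belongs to $\mathcal{F}_{pld}$.
   Context: A $C_0$-semigroup $\{T_t\}_{t\in\Delta}$ on a Banach space $X$ is a family of bounded linear operators on $X$ with $T_0=I$, $T_{t+s}=T_tT_s$ for all $s,t\in\Delta$, and $\lim_{s\to t}T_sx=T_tx$ for all $x\in X$, $t\in\Delta$. Let $m$ be Lebesgue measure on the plane and $\Delta_t:=\{s\in\Delta : |s|\le t\}$ for $t>0$. The lower density of a measurable set $A\subset\Delta$ is $$\underline{D}(A):=\liminf_{t\to\infty}\frac{m(A\cap\Delta_t)}{m(\Delta_t)}=\liminf_{t\to\infty}\frac{m(A\cap\Delta_t)}{\alpha t^2}.$$ A $C_0$-semigroup $\{T_t\}_{t\in\Delta}$ on $X$ is frequently hypercyclic if there exists $x\in X$ such that $\underline{D}(\{t\in\Delta : T_tx\in U\})>0$ for every non-empty open set $U\subset X$. $\mathcal{F}_{pld}:=\{A\subset\Delta : \underline{D}(A)>0\}$ is the family of all subsets of $\Delta$ having positive lower density. *)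

theory Defs
  imports "HOL-Analysis.Analysis"
begin

definition sector :: "real \<Rightarrow> complex set" where
  "sector \<alpha> = {rcis r \<theta> | r \<theta>. 0 \<le> r \<and> \<bar>\<theta>\<bar> \<le> \<alpha>}"

text \<open>The index set \<open>\<Delta>\<close> is a subset of the complex plane; an operator family is a total function
  on the plane whose values outside \<open>\<Delta>\<close> are irrelevant. The space is a real Banach space; a complex
  Banach space is covered through its underlying real structure, as none of the notions
  below refers to the scalar field except boundedness and linearity of the operators.\<close>

definition C0_semigroup_on :: "complex set \<Rightarrow> (complex \<Rightarrow> 'a::banach \<Rightarrow> 'a) \<Rightarrow> bool" where
  "C0_semigroup_on \<Delta> T \<longleftrightarrow>
     (\<forall>t\<in>\<Delta>. bounded_linear (T t)) \<and>
     T 0 = id \<and>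
     (\<forall>t\<in>\<Delta>. \<forall>s\<in>\<Delta>. T (t + s) = T t \<circ> T s) \<and>
     (\<forall>x. \<forall>t\<in>\<Delta>. ((\<lambda>s. T s x) \<longlongrightarrow> T t x) (at t within \<Delta>))"

definition truncation :: "complex set \<Rightarrow> real \<Rightarrow> complex set" where
  "truncation \<Delta> t = {s \<in> \<Delta>. cmod s \<le> t}"

text \<open>Meaningful for Lebesgue measurable \<open>A \<subseteq> \<Delta>\<close> only, since \<open>measure\<close> is \<open>0\<close> on
  non-measurable sets.\<close>

definition lower_density :: "complex set \<Rightarrow> complex set \<Rightarrow> ereal" where
  "lower_density \<Delta> A =
     Liminf at_top (\<lambda>t::real. ereal (measure lebesgue (A \<inter> truncation \<Delta> t)
                                      / measure lebesgue (truncation \<Delta> t)))"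

definition pos_lower_density_family :: "complex set \<Rightarrow> complex set set" where
  "pos_lower_density_family \<Delta> = {A. A \<subseteq> \<Delta> \<and> A \<in> sets lebesgue \<and> lower_density \<Delta> A > 0}"

definition frequently_hypercyclic ::
    "complex set \<Rightarrow> (complex \<Rightarrow> 'a::banach \<Rightarrow> 'a) \<Rightarrow> bool" where
  "frequently_hypercyclic \<Delta> T \<longleftrightarrow>
     (\<exists>x. \<forall>U. open U \<and> U \<noteq> {} \<longrightarrow> lower_density \<Delta> {t \<in> \<Delta>. T t x \<in> U} > 0)"

definition hitting_set ::
    "complex set \<Rightarrow> (complex \<Rightarrow> 'a \<Rightarrow> 'a) \<Rightarrow> 'a set \<Rightarrow> 'a set \<Rightarrow> complex set" where
  "hitting_set \<Delta> T U V = {t \<in> \<Delta>. T t ` U \<inter> V \<noteq> {}}"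

definition family_transitive ::
    "complex set set \<Rightarrow> complex set \<Rightarrow> (complex \<Rightarrow> 'a::banach \<Rightarrow> 'a) \<Rightarrow> bool" where
  "family_transitive \<F> \<Delta> T \<longleftrightarrow>
     (\<forall>U V. open U \<and> U \<noteq> {} \<and> open V \<and> V \<noteq> {} \<longrightarrow> hitting_set \<Delta> T U V \<in> \<F>)"

end

theory Submission
  imports Defs "HOL-Real_Asymp.Real_Asymp"
begin

text \<open>
  Let \<open>x\<close> be a frequently hypercyclic vector and \<open>U\<close>, \<open>V\<close> non-empty open sets. Some
  \<open>s \<in> \<Delta>\<close> has \<open>T s x \<in> U\<close>, and the set \<open>A\<close> of all \<open>u \<in> \<Delta>\<close> with \<open>T u x \<in> V\<close> has positive
  lower density. If \<open>t \<in> \<Delta>\<close> and \<open>s + t \<in> A\<close>, then \<open>T t\<close> maps the point \<open>T s x\<close> of \<open>U\<close> to the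
  point \<open>T (s + t) x\<close> of \<open>V\<close>; so the hitting set contains the part of \<open>A - s\<close> that lies
  in \<open>\<Delta>\<close>. It remains to see that shifting by \<open>s\<close> and cutting back to \<open>\<Delta>\<close> preserves positive
  lower density (\<open>lower_density_shift_pos\<close>).

  The points of \<open>A\<close> lost by this are those outside \<open>s + \<Delta>\<close>, a strip along the
  boundary of \<open>\<Delta>\<close>, and scaling alone bounds its area. As \<open>\<Delta>\<close> is a convex cone,
  \<open>s + \<Delta>\<^sub>R \<subseteq> \<Delta>\<^sub>R\<^sub>'\<close> for \<open>R' = R + \<bar>s\<bar>\<close>, while \<open>\<Delta>\<^sub>R\<close> has area \<open>M R\<^sup>2\<close> with
  \<open>M\<close> the area of \<open>\<Delta>\<^sub>1\<close>. So at most \<open>M (R + \<bar>s\<bar>)\<^sup>2 - M R\<^sup>2\<close> is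
  lost from \<open>A \<inter> \<Delta>\<^sub>R\<^sub>'\<close>. This grows linearly in \<open>R\<close>, while the area of \<open>A \<inter> \<Delta>\<^sub>R\<^sub>'\<close> grows at
  least quadratically.
\<close>

lemma sector_eq:
  assumes "0 \<le> \<alpha>" "\<alpha> \<le> pi"
  shows "sector \<alpha> = {z. cmod z * cos \<alpha> \<le> Re z}"
proof (intro equalityI subsetI)
  fix z assume "z \<in> sector \<alpha>"
  then obtain r \<theta> where z: "z = rcis r \<theta>" "0 \<le> r" "\<bar>\<theta>\<bar> \<le> \<alpha>"
    unfolding sector_def by blast
  have "cos \<alpha> \<le> cos \<bar>\<theta>\<bar>"
    using z assms by (intro cos_monotone_0_pi_le) auto
  then show "z \<in> {z. cmod z * cos \<alpha> \<le> Re z}"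
    using z by (auto intro: mult_left_mono)
next
  fix z assume z: "z \<in> {z. cmod z * cos \<alpha> \<le> Re z}"
  show "z \<in> sector \<alpha>"
  proof (cases "z = 0")
    case True
    then show ?thesis
      using assms unfolding sector_def by (auto intro!: exI[of _ 0])
  next
    case False
    have "Re z = cmod z * cos (Arg z)"
      by (metis Re_rcis rcis_cmod_Arg)
    then have "cos \<alpha> \<le> cos \<bar>Arg z\<bar>"
      using z False by simp
    then have "\<bar>Arg z\<bar> \<le> \<alpha>"
      using assms Arg_bounded[of z] by (subst (asm) cos_mono_le_eq) auto
    then show ?thesis
      unfolding sector_def using rcis_cmod_Arg[of z, symmetric] norm_ge_zero[of z] by blast
  qed
qed

lemma closed_sector:
  assumes "0 \<le> \<alpha>" "\<alpha> \<le> pi"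
  shows "closed (sector \<alpha>)"
  unfolding sector_eq[OF assms] by (intro closed_Collect_le continuous_intros)

text \<open>The bound \<open>\<alpha> \<le> \<pi> / 2\<close> makes \<open>cos \<alpha>\<close> non-negative, so that the
  description of the sector by \<open>cmod z * cos \<alpha> \<le> Re z\<close> is a convex condition.\<close>

lemma convex_cone_sector:
  assumes "0 \<le> \<alpha>" "\<alpha> \<le> pi / 2"
  shows "convex_cone (sector \<alpha>)"
proof -
  have eq: "sector \<alpha> = {z. cmod z * cos \<alpha> \<le> Re z}"
    using assms pi_gt_zero by (intro sector_eq) linarith+
  have cos: "0 \<le> cos \<alpha>"
    using assms by (intro cos_ge_zero) auto
  have "cmod (x + y) * cos \<alpha> \<le> Re x + Re y"
    if "cmod x * cos \<alpha> \<le> Re x" "cmod y * cos \<alpha> \<le> Re y" for x y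
    using mult_right_mono[OF norm_triangle_ineq cos, of x y] that by (simp add: distrib_right)
  then show ?thesis
    unfolding eq convex_cone_iff by (auto simp: mult.assoc intro: mult_left_mono)
qed

lemma lmeasurable_truncation:
  assumes "closed \<Delta>"
  shows "truncation \<Delta> r \<in> lmeasurable"
proof -
  have "truncation \<Delta> r = \<Delta> \<inter> cball 0 r"
    by (auto simp: truncation_def)
  then show ?thesis
    using assms by (simp add: lmeasurable_compact closed_Int_compact)
qed

lemma truncation_scaleR:
  assumes "convex_cone \<Delta>" "0 < r"
  shows "truncation \<Delta> r = (*\<^sub>R) r ` truncation \<Delta> 1"
proof (intro equalityI subsetI)
  fix z assume "z \<in> truncation \<Delta> r"
  then have "z /\<^sub>R r \<in> truncation \<Delta> 1"
    using assms by (auto simp: truncation_def convex_cone_scaleR field_simps)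
  moreover have "z = r *\<^sub>R (z /\<^sub>R r)"
    using assms by simp
  ultimately show "z \<in> (*\<^sub>R) r ` truncation \<Delta> 1"
    by blast
next
  fix z assume "z \<in> (*\<^sub>R) r ` truncation \<Delta> 1"
  then show "z \<in> truncation \<Delta> r"
    using assms by (auto simp: truncation_def convex_cone_scaleR)
qed

lemma measure_truncation:
  assumes "convex_cone \<Delta>" "0 < r"
  shows "measure lebesgue (truncation \<Delta> r) = measure lebesgue (truncation \<Delta> 1) * r\<^sup>2"
  using measure_lebesgue_affine[of r 0 "truncation \<Delta> 1"] assms
  by (simp add: truncation_scaleR[OF assms] mult.commute)

text \<open>Inside \<open>\<Delta>\<^sub>R\<^sub>'\<close> with \<open>R' = R + \<bar>s\<bar>\<close> lie both \<open>A \<inter> \<Delta>\<^sub>R\<^sub>'\<close> and the copy \<open>s + \<Delta>\<^sub>R\<close> of \<open>\<Delta>\<^sub>R\<close>;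
  by inclusion-exclusion their intersection, which is a translate of
  \<open>(A - s) \<inter> \<Delta>\<^sub>R\<close>, has at least the area stated.\<close>

lemma measure_shift_truncation_ge:
  assumes \<Delta>: "closed \<Delta>" "convex_cone \<Delta>" and s: "s \<in> \<Delta>" and A: "A \<in> sets lebesgue"
  shows "measure lebesgue (A \<inter> truncation \<Delta> (R + cmod s)) + measure lebesgue (truncation \<Delta> R)
           - measure lebesgue (truncation \<Delta> (R + cmod s))
         \<le> measure lebesgue ({t \<in> \<Delta>. s + t \<in> A} \<inter> truncation \<Delta> R)"
proof -
  define D where "D = truncation \<Delta> (R + cmod s)"
  define B where "B = A \<inter> D"
  define C where "C = (+) s ` truncation \<Delta> R"
  have D: "D \<in> lmeasurable"
    unfolding D_def using \<Delta> by (intro lmeasurable_truncation)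
  have B: "B \<in> lmeasurable"
    unfolding B_def using A D by (intro fmeasurable_Int_fmeasurable[where S=D and T=A, simplified Int_commute])
  have C: "C \<in> lmeasurable"
    unfolding C_def using lmeasurable_truncation[OF \<Delta>(1)] by (rule measurable_translation)
  have CD: "C \<subseteq> D"
    using s \<Delta>(2) unfolding C_def D_def truncation_def
    by (auto intro: convex_cone_add) (smt (verit) norm_triangle_ineq)
  have "B \<inter> C = (+) s ` ({t \<in> \<Delta>. s + t \<in> A} \<inter> truncation \<Delta> R)"
    using CD unfolding B_def C_def by (auto simp: truncation_def)
  then have "measure lebesgue (B \<inter> C) = measure lebesgue ({t \<in> \<Delta>. s + t \<in> A} \<inter> truncation \<Delta> R)"
    by (simp add: measure_translation)
  moreover have "measure lebesgue (B \<union> C) + measure lebesgue (B \<inter> C)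
      = measure lebesgue B + measure lebesgue C"
    using B C by (simp add: measure_Un3)
  moreover have "measure lebesgue (B \<union> C) \<le> measure lebesgue D"
    using B C CD D by (intro measure_mono_fmeasurable) (auto simp: B_def)
  moreover have "measure lebesgue C = measure lebesgue (truncation \<Delta> R)"
    unfolding C_def by (rule measure_translation)
  ultimately show ?thesis
    unfolding B_def D_def by linarith
qed

text \<open>Dividing the bound above by the area \<open>M R\<^sup>2\<close> of \<open>\<Delta>\<^sub>R\<close> turns the area lost by the shift into a
  term of order \<open>1 / R\<close>, so the lower density cannot drop to \<open>0\<close>.\<close>

lemma lower_density_shift_pos:
  assumes \<Delta>: "closed \<Delta>" "convex_cone \<Delta>" and s: "s \<in> \<Delta>" and A: "A \<in> sets lebesgue"
    and pos: "lower_density \<Delta> A > 0"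
  shows "lower_density \<Delta> {t \<in> \<Delta>. s + t \<in> A} > 0"
proof -
  define M where "M = measure lebesgue (truncation \<Delta> 1)"
  define f where "f B r = measure lebesgue (B \<inter> truncation \<Delta> r)" for B r
  have tr: "measure lebesgue (truncation \<Delta> r) = M * r\<^sup>2" if "0 < r" for r
    unfolding M_def using that \<Delta> by (intro measure_truncation)
  obtain c where c: "0 < c" "ereal c < lower_density \<Delta> A"
    using ereal_dense2[OF pos] by (metis ereal_less(2))
  have ev: "eventually (\<lambda>r. c < f A r / (M * r\<^sup>2)) at_top"
    using less_LiminfD[OF c(2)[unfolded lower_density_def]] eventually_gt_at_top[of 0]
    by eventually_elim (simp add: f_def tr)
  \<comment> \<open>If \<open>M = 0\<close>, all quotients would be \<open>0\<close>.\<close>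
  have M: "0 < M"
  proof -
    obtain r where "c < f A r / (M * r\<^sup>2)"
      using eventually_happens[OF ev] by auto
    then have "M \<noteq> 0"
      using c by auto
    then show ?thesis
      by (simp add: M_def less_le)
  qed
  have "filterlim (\<lambda>R. R + cmod s) at_top at_top"
    by real_asymp
  then have ev': "eventually (\<lambda>R. c < f A (R + cmod s) / (M * (R + cmod s)\<^sup>2)) at_top"
    using ev by (rule eventually_compose_filterlim[rotated])
  \<comment> \<open>The loss \<open>(R + cmod s)\<^sup>2 - R\<^sup>2\<close> is linear in \<open>R\<close>, so any factor below \<open>c\<close> would do in
    place of \<open>c / 2\<close>.\<close>
  have "eventually (\<lambda>R. c / 2 * R\<^sup>2 \<le> c * (R + cmod s)\<^sup>2 + R\<^sup>2 - (R + cmod s)\<^sup>2) at_top"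
    using c(1) by real_asymp
  with ev' have "eventually (\<lambda>R. ereal (c / 2) \<le> ereal (f {t \<in> \<Delta>. s + t \<in> A} R /
      measure lebesgue (truncation \<Delta> R))) at_top"
    using eventually_gt_at_top[of 0]
  proof eventually_elim
    case (elim R)
    have R: "0 < R + cmod s"
      using elim norm_ge_zero[of s] by linarith
    have "c / 2 * (M * R\<^sup>2) = M * (c / 2 * R\<^sup>2)"
      by simp
    also have "\<dots> \<le> M * (c * (R + cmod s)\<^sup>2 + R\<^sup>2 - (R + cmod s)\<^sup>2)"
      using elim M by (intro mult_left_mono) auto
    also have "\<dots> = c * (M * (R + cmod s)\<^sup>2) + M * R\<^sup>2 - M * (R + cmod s)\<^sup>2"
      by (simp add: algebra_simps)
    also have "\<dots> \<le> f A (R + cmod s) + M * R\<^sup>2 - M * (R + cmod s)\<^sup>2"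
      using elim(1) M R by (simp add: pos_less_divide_eq)
    also have "\<dots> \<le> f {t \<in> \<Delta>. s + t \<in> A} R"
      using measure_shift_truncation_ge[OF \<Delta> s A, of R] tr[OF R] tr[OF elim(3)]
      by (simp add: f_def)
    finally show ?case
      using M elim(3) by (simp add: tr pos_le_divide_eq)
  qed
  then have "ereal (c / 2) \<le> lower_density \<Delta> {t \<in> \<Delta>. s + t \<in> A}"
    unfolding lower_density_def f_def by (rule Liminf_bounded)
  then show ?thesis
    using c(1) by (auto intro: less_le_trans[of _ "ereal (c / 2)"])
qed

lemma lower_density_mono:
  assumes "closed \<Delta>" "A \<subseteq> B" "A \<in> sets lebesgue" "B \<in> sets lebesgue"
  shows "lower_density \<Delta> A \<le> lower_density \<Delta> B"
  unfolding lower_density_def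
proof (intro Liminf_mono always_eventually allI)
  fix r
  have D: "truncation \<Delta> r \<in> lmeasurable"
    using assms(1) by (rule lmeasurable_truncation)
  have "measure lebesgue (A \<inter> truncation \<Delta> r) \<le> measure lebesgue (B \<inter> truncation \<Delta> r)"
    using assms D
    by (intro measure_mono_fmeasurable sets.Int fmeasurable_Int_fmeasurable[where S="truncation \<Delta> r", simplified Int_commute]) auto
  then show "ereal (measure lebesgue (A \<inter> truncation \<Delta> r) / measure lebesgue (truncation \<Delta> r))
      \<le> ereal (measure lebesgue (B \<inter> truncation \<Delta> r) / measure lebesgue (truncation \<Delta> r))"
    by (simp add: divide_right_mono)
qed

lemma lower_density_empty: "lower_density \<Delta> {} = 0"
  by (simp add: lower_density_def Liminf_const zero_ereal_def)

text \<open>By strong continuity, times at which an orbit visits an open set are relatively open in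
  \<open>\<Delta>\<close>. A hitting set is a union of such sets over the possibly uncountable \<open>U\<close>, and is
  measurable because this union is again relatively open.\<close>

lemma openin_visiting_times:
  assumes "C0_semigroup_on \<Delta> T" "open V"
  shows "openin (top_of_set \<Delta>) {t \<in> \<Delta>. T t x \<in> V}"
proof -
  have "continuous_on \<Delta> (\<lambda>t. T t x)"
    using assms(1) by (simp add: C0_semigroup_on_def continuous_on_def)
  then have "openin (top_of_set \<Delta>) (\<Delta> \<inter> (\<lambda>t. T t x) -` V)"
    using assms(2) by (rule continuous_openin_preimage_gen)
  then show ?thesis
    by (simp add: vimage_def Int_def)
qed

lemma openin_hitting_set:
  assumes "C0_semigroup_on \<Delta> T" "open V"
  shows "openin (top_of_set \<Delta>) (hitting_set \<Delta> T U V)"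
proof -
  have "hitting_set \<Delta> T U V = (\<Union>u\<in>U. {t \<in> \<Delta>. T t u \<in> V})"
    by (auto simp: hitting_set_def)
  then show ?thesis
    using openin_visiting_times[OF assms] by auto
qed

lemma sets_lebesgue_openin_closed:
  fixes S :: "'a::euclidean_space set"
  assumes "closed S" "openin (top_of_set S) A"
  shows "A \<in> sets lebesgue"
  using assms by (auto simp: openin_open intro!: sets.Int)

lemma shifted_visiting_times_subset_hitting_set:
  assumes "C0_semigroup_on \<Delta> T" "s \<in> \<Delta>" "T s x \<in> U"
  shows "{t \<in> \<Delta>. s + t \<in> {u \<in> \<Delta>. T u x \<in> V}} \<subseteq> hitting_set \<Delta> T U V"
proof
  fix t assume t: "t \<in> {t \<in> \<Delta>. s + t \<in> {u \<in> \<Delta>. T u x \<in> V}}"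
  then have "T (t + s) = T t \<circ> T s"
    using assms by (auto simp: C0_semigroup_on_def)
  then have "T t (T s x) \<in> V"
    using t by (simp add: add.commute)
  then show "t \<in> hitting_set \<Delta> T U V"
    using t assms(3) by (auto simp: hitting_set_def)
qed

theorem theorem2p2:
  fixes \<alpha> :: real and \<Delta> :: "complex set" and T :: "complex \<Rightarrow> 'a::banach \<Rightarrow> 'a"
  assumes "0 < \<alpha>" and "\<alpha> \<le> pi / 2"
    and "\<Delta> = sector \<alpha>"
    and "separable_space (euclidean :: 'a topology)"
    and "C0_semigroup_on \<Delta> T"
    and "frequently_hypercyclic \<Delta> T"
  shows "family_transitive (pos_lower_density_family \<Delta>) \<Delta> T"
  unfolding family_transitive_def
proof (intro allI impI, elim conjE)
  fix U V :: "'a set"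
  assume U: "open U" "U \<noteq> {}" and V: "open V" "V \<noteq> {}"
  have closed: "closed \<Delta>" and cone: "convex_cone \<Delta>"
    using assms(1-3) pi_gt_zero closed_sector[of \<alpha>] convex_cone_sector[of \<alpha>] by auto
  obtain x where x: "\<And>W. open W \<Longrightarrow> W \<noteq> {} \<Longrightarrow> lower_density \<Delta> {t \<in> \<Delta>. T t x \<in> W} > 0"
    using assms(6) unfolding frequently_hypercyclic_def by blast
  have "{t \<in> \<Delta>. T t x \<in> U} \<noteq> {}"
    using x[OF U] lower_density_empty[of \<Delta>] by (metis less_irrefl)
  then obtain s where s: "s \<in> \<Delta>" "T s x \<in> U"
    by blast
  define A where "A = {t \<in> \<Delta>. T t x \<in> V}"
  define N where "N = hitting_set \<Delta> T U V"
  have A: "A \<in> sets lebesgue"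
    unfolding A_def using closed openin_visiting_times[OF assms(5) V(1)]
    by (rule sets_lebesgue_openin_closed)
  have N: "N \<in> sets lebesgue"
    unfolding N_def using closed openin_hitting_set[OF assms(5) V(1)]
    by (rule sets_lebesgue_openin_closed)
  have shift: "{t \<in> \<Delta>. s + t \<in> A} \<in> sets lebesgue"
  proof -
    have "{t \<in> \<Delta>. s + t \<in> A} = \<Delta> \<inter> (\<lambda>a. a - s) ` A"
      by (force simp: algebra_simps)
    then show ?thesis
      using closed A lebesgue_sets_translation[of A "- s"] by (auto intro!: sets.Int)
  qed
  have "0 < lower_density \<Delta> {t \<in> \<Delta>. s + t \<in> A}"
    using lower_density_shift_pos[OF closed cone s(1) A] x[OF V] by (simp add: A_def)
  also have "\<dots> \<le> lower_density \<Delta> N"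
    using shifted_visiting_times_subset_hitting_set[OF assms(5) s, of V] closed shift N
    by (intro lower_density_mono) (auto simp: A_def N_def)
  finally have "lower_density \<Delta> N > 0" .
  then show "hitting_set \<Delta> T U V \<in> pos_lower_density_family \<Delta>"
    using N by (auto simp: pos_lower_density_family_def N_def hitting_set_def)
qed

end
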